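(* For every odd $m\ge 3$, the Sperner systems $\mathcal{S}^m_1$ and $\mathcal{S}^m_2$ are nonisomorphic.
   Context: A set system over a finite set $A$ is a set of subsets of $A$, called blocks; it is a Sperner system if no block is included in another. Set systems $\mathcal A$ over $A$ and $\mathcal B$ over $B$ are isomorphic if there is a bijection $\sigma\colon A\to B$ with $\{\sigma(S):S\in\mathcal A\}=\mathcal B$. Let $[m]=\{1,\dots,m\}$. For each $n\in[m]$ let $n'$ be a new element (a primed copy of $n$), and $S'=\{n':n\in S\}$ for $S\subseteq[m]$. Let $E_m=[m]\cup[m]'$ ($2m$ elements). Addition in $[m]$ is modulo $m$ with result in $[m]$; $X+q=\{x+q:x\in X\}$. Let $\rho$ be the permutation of $E_m$ with $\rho(j)=j+1$, $\rho(j')=(j+1)'$; for a set system $\mathcal A$ over $E_m$ let $\langle\mathcal A\rangle=\bigcup_{i\in[m]}\rho^i(\mathcal A)$. For $J\subseteq[m]$ let $F^m_J=J\cup([m]\setminus J)'$; $\mathcal F^m_1=\{F^m_J:|J|\text{ odd}\}$, $\mathcal F^m_2=\{F^m_J:|J|\text{ even}\}$. For disjoint $X,Y\subseteq[m]$ let $[X|Y]$ be the set of all $J\subseteq E_m$ such that $|\{x,x'\}\cap J|=2$ for all $x\in X$, $|\{y,y'\}\cap J|=0$ for all $y\in Y$, and $|\{z,z'\}\cap J|=1$ for all $z\in[m]\setminus(X\cup Y)$. Let $\langle X|Y\rangle=\langle[X|Y]\rangle=\bigcup_{q\in[m]}[X+q|Y+q]$. Let $\Omega=\{\langle X|Y\rangle: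 X,Y\subseteq[m],\ |X|=|Y|,\ X\cap Y=\emptyset\}\setminus\{\langle\emptyset|\emptyset\rangle\}$. Signature: for disjoint $X,Y\subseteq[m]$, $(X,Y)\ne(\emptyset,\emptyset)$, let $d_1\dots d_m$ be the string with $d_i=x$ if $i\in X$, $d_i=y$ if $i\in Y$, $d_i=z$ otherwise. Let $d'_1\dots d'_m$ be the unique string (indices cyclic modulo $m$) such that $d'_i=d_i$ if $d_i\in\{x,y\}$; and if $d_i=z$ then $d'_i\in\{\alpha,\beta\}$, $d'_i\ne d'_{i-1}$, with $d'_i=\beta$ if $d_{i-1}=x$ and $d'_i=\alpha$ if $d_{i-1}=y$. Then $\mathrm{sgn}(X,Y)$ is the set of those $e\in\{\alpha,\beta\}$ that occur an odd number of times in $d'_1\dots d'_m$; the singletons $\{\alpha\},\{\beta\}$ are written $\alpha,\beta$. It is invariant under replacing $(X,Y)$ by $(X+q,Y+q)$, and $\mathrm{sgn}\langle X|Y\rangle:=\mathrm{sgn}(X,Y)$ is well defined. For odd $m\ge3$ let $C_m=\{1,3,\dots,m-2\}$, $A_m=\{m\}\cup(C_m+1)\cup(C_m+1)'$, $B_m=\{m\}\cup C_m\cup C_m'$, and $$\mathcal H^m=\langle\{A_m,B_m\}\rangle\cup\bigcup\{Q\in\Omega\setminus\{\langle C_m|C_m+1\rangle,\langle C_m+1|C_m\rangle\}:\mathrm{sgn}\,Q=\beta\}.$$ For $i\in\{1,2\}$ let $\mathcal S^m_i=\mathcal H^m\cup\mathcal F^m_i$, a Sperner system over $E_m$. *)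

theory Defs
  imports "HOL-Library.FuncSet"
begin

definition set_system :: "'a set \<Rightarrow> 'a set set \<Rightarrow> bool" where
  "set_system A \<A> \<longleftrightarrow> finite A \<and> \<A> \<subseteq> Pow A"

definition sperner_system :: "'a set \<Rightarrow> 'a set set \<Rightarrow> bool" where
  "sperner_system A \<A> \<longleftrightarrow>
     set_system A \<A> \<and> (\<forall>S\<in>\<A>. \<forall>T\<in>\<A>. S \<subseteq> T \<longrightarrow> S = T)"

definition isomorphic_systems :: "'a set \<Rightarrow> 'a set set \<Rightarrow> 'b set \<Rightarrow> 'b set set \<Rightarrow> bool" where
  "isomorphic_systems A \<A> B \<B> \<longleftrightarrow> (\<exists>\<sigma>. bij_betw \<sigma> A B \<and> {\<sigma> ` S | S. S \<in> \<A>} = \<B>)"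

text \<open>The element \<open>n\<close> of \<open>E m\<close> is \<open>Inl n\<close>, and its primed copy is \<open>Inr n\<close>.\<close>

definition E :: "nat \<Rightarrow> (nat + nat) set" where
  "E m = Inl ` {1..m} \<union> Inr ` {1..m}"

text \<open>Addition modulo \<open>m\<close> with representatives \<open>1, \<dots>, m\<close>; meant for \<open>x \<ge> 1\<close>,
  since the subtraction truncates.\<close>

definition cadd :: "nat \<Rightarrow> nat \<Rightarrow> nat \<Rightarrow> nat" where
  "cadd m x q = (x + q - 1) mod m + 1"

definition shift :: "nat \<Rightarrow> nat set \<Rightarrow> nat \<Rightarrow> nat set" where
  "shift m X q = {cadd m x q | x. x \<in> X}"

definition rho :: "nat \<Rightarrow> nat + nat \<Rightarrow> nat + nat" where
  "rho m = map_sum (\<lambda>j. cadd m j 1) (\<lambda>j. cadd m j 1)"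

definition orbit_system :: "nat \<Rightarrow> (nat + nat) set set \<Rightarrow> (nat + nat) set set" where
  "orbit_system m \<A> = (\<Union>i\<in>{1..m}. {(rho m ^^ i) ` S | S. S \<in> \<A>})"

definition F_set :: "nat \<Rightarrow> nat set \<Rightarrow> (nat + nat) set" where
  "F_set m J = Inl ` J \<union> Inr ` ({1..m} - J)"

definition F1_system :: "nat \<Rightarrow> (nat + nat) set set" where
  "F1_system m = {F_set m J | J. J \<subseteq> {1..m} \<and> odd (card J)}"

definition F2_system :: "nat \<Rightarrow> (nat + nat) set set" where
  "F2_system m = {F_set m J | J. J \<subseteq> {1..m} \<and> even (card J)}"

definition bracket :: "nat \<Rightarrow> nat set \<Rightarrow> nat set \<Rightarrow> (nat + nat) set set" where
  "bracket m X Y = {J. J \<subseteq> E m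
     \<and> (\<forall>x\<in>X. card ({Inl x, Inr x} \<inter> J) = 2)
     \<and> (\<forall>y\<in>Y. card ({Inl y, Inr y} \<inter> J) = 0)
     \<and> (\<forall>z\<in>{1..m} - (X \<union> Y). card ({Inl z, Inr z} \<inter> J) = 1)}"

definition bracket_orbit :: "nat \<Rightarrow> nat set \<Rightarrow> nat set \<Rightarrow> (nat + nat) set set" where
  "bracket_orbit m X Y = orbit_system m (bracket m X Y)"

definition Omega :: "nat \<Rightarrow> (nat + nat) set set set" where
  "Omega m = {bracket_orbit m X Y | X Y.
     X \<subseteq> {1..m} \<and> Y \<subseteq> {1..m} \<and> card X = card Y \<and> X \<inter> Y = {}} - {bracket_orbit m {} {}}"

datatype letter = LX | LY | LZ | Alpha | Beta

definition d_string :: "nat set \<Rightarrow> nat set \<Rightarrow> nat \<Rightarrow> letter" where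
  "d_string X Y i = (if i \<in> X then LX else if i \<in> Y then LY else LZ)"

text \<open>Strings \<open>d'\<close> of length \<open>m\<close> are functions on \<open>{1..m}\<close> that are \<open>undefined\<close> elsewhere, so
  that uniqueness of \<open>d'\<close> makes sense. The index \<open>cadd m i (m - 1)\<close> is the cyclic
  predecessor of \<open>i\<close>.\<close>

definition is_sig_string :: "nat \<Rightarrow> nat set \<Rightarrow> nat set \<Rightarrow> (nat \<Rightarrow> letter) \<Rightarrow> bool" where
  "is_sig_string m X Y d' \<longleftrightarrow> d' \<in> extensional {1..m} \<and>
     (\<forall>i\<in>{1..m}.
        (d_string X Y i \<in> {LX, LY} \<longrightarrow> d' i = d_string X Y i) \<and>
        (d_string X Y i = LZ \<longrightarrow>
           d' i \<in> {Alpha, Beta} \<and>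
           d' i \<noteq> d' (cadd m i (m - 1)) \<and>
           (d_string X Y (cadd m i (m - 1)) = LX \<longrightarrow> d' i = Beta) \<and>
           (d_string X Y (cadd m i (m - 1)) = LY \<longrightarrow> d' i = Alpha)))"

definition sig_string :: "nat \<Rightarrow> nat set \<Rightarrow> nat set \<Rightarrow> nat \<Rightarrow> letter" where
  "sig_string m X Y = (THE d'. is_sig_string m X Y d')"

definition signature :: "nat \<Rightarrow> nat set \<Rightarrow> nat set \<Rightarrow> letter set" where
  "signature m X Y = {e \<in> {Alpha, Beta}. odd (card {i \<in> {1..m}. sig_string m X Y i = e})}"

text \<open>The signature of an orbit is the common value of the signatures of the pairs
  representing it.\<close>

definition orbit_signature :: "nat \<Rightarrow> (nat + nat) set set \<Rightarrow> letter set" where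
  "orbit_signature m Q = (THE s. \<exists>X Y. X \<subseteq> {1..m} \<and> Y \<subseteq> {1..m} \<and> X \<inter> Y = {} \<and>
     (X, Y) \<noteq> ({}, {}) \<and> Q = bracket_orbit m X Y \<and> s = signature m X Y)"

definition C_set :: "nat \<Rightarrow> nat set" where
  "C_set m = {n \<in> {1..m - 2}. odd n}"

definition A_block :: "nat \<Rightarrow> (nat + nat) set" where
  "A_block m = {Inl m} \<union> Inl ` shift m (C_set m) 1 \<union> Inr ` shift m (C_set m) 1"

definition B_block :: "nat \<Rightarrow> (nat + nat) set" where
  "B_block m = {Inl m} \<union> Inl ` C_set m \<union> Inr ` C_set m"

definition H_system :: "nat \<Rightarrow> (nat + nat) set set" where
  "H_system m = orbit_system m {A_block m, B_block m} \<union>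
     \<Union>{Q \<in> Omega m - {bracket_orbit m (C_set m) (shift m (C_set m) 1),
                       bracket_orbit m (shift m (C_set m) 1) (C_set m)}.
         orbit_signature m Q = {Beta}}"

definition S1_system :: "nat \<Rightarrow> (nat + nat) set set" where
  "S1_system m = H_system m \<union> F1_system m"

definition S2_system :: "nat \<Rightarrow> (nat + nat) set set" where
  "S2_system m = H_system m \<union> F2_system m"

text \<open>Both systems are Sperner because all their blocks have exactly \<open>m\<close> elements.\<close>

lemma finite_E: "finite (E m)"
  by (simp add: E_def)

lemma bracket_card:
  assumes "X \<subseteq> {1..m}" "Y \<subseteq> {1..m}" "card X = card Y" "X \<inter> Y = {}" "J \<in> bracket m X Y"
  shows "card J = m"
proof -
  let ?P = "\<lambda>i. {Inl i, Inr i} \<inter> J"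
  have J: "J = (\<Union>i\<in>{1..m}. ?P i)"
    using assms(5) by (auto simp: bracket_def E_def)
  have fin: "finite X" "finite Y"
    using assms(1,2) finite_subset by blast+
  have split: "{1..m} = X \<union> Y \<union> ({1..m} - (X \<union> Y))"
    using assms(1,2) by blast
  have "card J = (\<Sum>i\<in>{1..m}. card (?P i))"
    by (subst J, rule card_UN_disjoint) auto
  also have "\<dots> = (\<Sum>i\<in>X \<union> Y. card (?P i)) + (\<Sum>i\<in>{1..m} - (X \<union> Y). card (?P i))"
    by (subst split, rule sum.union_disjoint) (use fin in auto)
  also have "(\<Sum>i\<in>X \<union> Y. card (?P i)) = (\<Sum>i\<in>X. card (?P i)) + (\<Sum>i\<in>Y. card (?P i))"
    by (rule sum.union_disjoint) (use fin assms(4) in auto)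
  also have "(\<Sum>i\<in>X. card (?P i)) = (\<Sum>i\<in>X. 2)"
    using assms(5) by (intro sum.cong) (auto simp: bracket_def)
  also have "(\<Sum>i\<in>Y. card (?P i)) = (\<Sum>i\<in>Y. 0)"
    using assms(5) by (intro sum.cong) (auto simp: bracket_def)
  also have "(\<Sum>i\<in>{1..m} - (X \<union> Y). card (?P i)) = (\<Sum>i\<in>{1..m} - (X \<union> Y). 1)"
    using assms(5) by (intro sum.cong) (auto simp: bracket_def)
  finally have c: "card J = 2 * card X + card ({1..m} - (X \<union> Y))"
    by simp
  have u: "card (X \<union> Y) = card X + card Y"
    using fin assms(4) by (rule card_Un_disjoint)
  have "card (X \<union> Y) \<le> card {1..m}"
    using assms(1,2) by (intro card_mono) auto
  moreover have "card ({1..m} - (X \<union> Y)) = m - card (X \<union> Y)"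
    using assms(1,2) fin by (subst card_Diff_subset) auto
  ultimately show ?thesis
    using c u assms(3) by simp
qed

lemma cadd_in: "m \<ge> 1 \<Longrightarrow> cadd m x q \<in> {1..m}"
  by (simp add: cadd_def Suc_leI)

lemma inj_on_cadd: "inj_on (\<lambda>x. cadd m x q) {1..m}"
proof (rule inj_onI)
  fix x y assume xy: "x \<in> {1..m}" "y \<in> {1..m}" and eq: "cadd m x q = cadd m y q"
  have "(x - 1 + q) mod m = (y - 1 + q) mod m"
    using eq xy by (simp add: cadd_def)
  then have "int (x - 1 + q) mod int m = int (y - 1 + q) mod int m"
    by (metis zmod_int)
  then have "int (x - 1) mod int m = int (y - 1) mod int m"
    by (metis mod_diff_left_eq add_diff_cancel_right' of_nat_add)
  then show "x = y"
    using xy by (auto simp: of_nat_diff)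
qed

lemma rho_in:
  assumes "e \<in> E m"
  shows "rho m e \<in> E m"
proof -
  have "m \<ge> 1"
    using assms by (auto simp: E_def)
  then have "cadd m j 1 \<in> {1..m}" for j
    by (rule cadd_in)
  then show ?thesis
    using assms unfolding E_def rho_def by force
qed

lemma inj_on_rho: "inj_on (rho m) (E m)"
proof (rule inj_onI)
  fix a b assume "a \<in> E m" "b \<in> E m" "rho m a = rho m b"
  then show "a = b"
    unfolding E_def rho_def using inj_onD[OF inj_on_cadd[of m 1]] by (elim UnE imageE) simp_all
qed

lemma rho_pow: "inj_on (rho m ^^ i) (E m) \<and> (rho m ^^ i) ` E m \<subseteq> E m"
proof (induction i)
  case (Suc i)
  then have "inj_on (rho m \<circ> (rho m ^^ i)) (E m)"
    by (intro comp_inj_on) (auto intro: inj_on_subset[OF inj_on_rho])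
  with Suc show ?case
    using rho_in by (auto simp: image_subset_iff comp_def)
qed simp

lemma orbit_system_uniform:
  assumes "\<And>S. S \<in> \<A> \<Longrightarrow> S \<subseteq> E m \<and> card S = k" and "T \<in> orbit_system m \<A>"
  shows "T \<subseteq> E m \<and> card T = k"
proof -
  obtain i S where T: "T = (rho m ^^ i) ` S" "S \<in> \<A>"
    using assms(2) by (auto simp: orbit_system_def)
  then have S: "S \<subseteq> E m" "card S = k"
    using assms(1) by blast+
  have "card T = card S"
    unfolding T(1) by (rule card_image) (rule inj_on_subset[OF conjunct1[OF rho_pow] S(1)])
  moreover have "T \<subseteq> E m"
    unfolding T(1) using image_mono[OF S(1)] conjunct2[OF rho_pow] by (rule order_trans)
  ultimately show ?thesis
    using S(2) by simp
qed

lemma card_C_set: "odd m \<Longrightarrow> m \<ge> 3 \<Longrightarrow> 2 * card (C_set m) + 1 = m"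
proof -
  assume m: "odd m" "m \<ge> 3"
  then obtain k where k: "m = 2 * k + 1" "k \<ge> 1"
    by (auto elim!: oddE)
  have "C_set m = (\<lambda>j. 2 * j + 1) ` {..<k}"
    using k by (auto simp: C_set_def image_iff elim!: oddE)
  then have "card (C_set m) = k"
    by (simp add: card_image inj_on_def)
  then show ?thesis
    using k by simp
qed

lemma shift_C_set: "m \<ge> 3 \<Longrightarrow> shift m (C_set m) 1 = Suc ` C_set m"
proof -
  assume "m \<ge> 3"
  then have "cadd m x 1 = Suc x" if "x \<in> C_set m" for x
    using that by (auto simp: cadd_def C_set_def)
  then show ?thesis
    unfolding shift_def by force
qed

lemma doubled_block:
  assumes "D \<subseteq> {1..m - 1}" and "2 * card D + 1 = m"
  shows "{Inl m} \<union> Inl ` D \<union> Inr ` D \<subseteq> E m \<and> card ({Inl m} \<union> Inl ` D \<union> Inr ` D) = m"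
proof -
  have fin: "finite D"
    using assms(1) finite_subset by blast
  have m: "m \<ge> 1"
    using assms(2) by linarith
  then have sub: "insert m D \<subseteq> {1..m}" and "m \<notin> D"
    using assms(1) by fastforce+
  moreover have "{Inl m} \<union> Inl ` D \<union> Inr ` D = insert m D <+> D"
    by (auto simp: Plus_def)
  moreover have "insert m D <+> D \<subseteq> E m"
    using sub by (auto simp: Plus_def E_def)
  ultimately show ?thesis
    using fin assms(2) by (simp add: card_Plus)
qed

lemma AB_blocks:
  assumes "odd m" "m \<ge> 3"
  shows "A_block m \<subseteq> E m \<and> card (A_block m) = m" "B_block m \<subseteq> E m \<and> card (B_block m) = m"
proof -
  have "C_set m \<subseteq> {1..m - 1}" "Suc ` C_set m \<subseteq> {1..m - 1}"
    using assms by (auto simp: C_set_def)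
  moreover have "card (Suc ` C_set m) = card (C_set m)"
    by (simp add: card_image)
  ultimately show "A_block m \<subseteq> E m \<and> card (A_block m) = m"
      "B_block m \<subseteq> E m \<and> card (B_block m) = m"
    unfolding A_block_def B_block_def shift_C_set[OF assms(2)]
    using card_C_set[OF assms] doubled_block[of "C_set m" m] doubled_block[of "Suc ` C_set m" m]
    by presburger+
qed

lemma F_set_uniform:
  assumes "J \<subseteq> {1..m}"
  shows "F_set m J \<subseteq> E m \<and> card (F_set m J) = m"
proof -
  have fin: "finite J"
    using assms finite_subset by blast
  have "card J \<le> card {1..m}"
    using assms by (intro card_mono) auto
  moreover have "F_set m J = J <+> ({1..m} - J)"
    by (auto simp: F_set_def Plus_def)
  ultimately have "card (F_set m J) = m"
    using fin assms by (simp add: card_Plus card_Diff_subset)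
  then show ?thesis
    using assms by (auto simp: F_set_def E_def)
qed

lemma H_system_uniform:
  assumes "odd m" "m \<ge> 3" "T \<in> H_system m"
  shows "T \<subseteq> E m \<and> card T = m"
proof -
  consider "T \<in> orbit_system m {A_block m, B_block m}" | Q where "Q \<in> Omega m" "T \<in> Q"
    using assms(3) by (auto simp: H_system_def)
  then show ?thesis
  proof cases
    case 1
    then show ?thesis
      using AB_blocks[OF assms(1,2)] by (elim orbit_system_uniform[rotated]) auto
  next
    case 2
    then obtain X Y where XY: "X \<subseteq> {1..m}" "Y \<subseteq> {1..m}" "card X = card Y" "X \<inter> Y = {}"
      and T: "T \<in> orbit_system m (bracket m X Y)"
      by (auto simp: Omega_def bracket_orbit_def)
    have "S \<subseteq> E m \<and> card S = m" if "S \<in> bracket m X Y" for S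
      using bracket_card[OF XY that] that by (auto simp: bracket_def)
    then show ?thesis
      using T by (rule orbit_system_uniform)
  qed
qed

lemma uniform_sperner:
  assumes "\<And>T. T \<in> \<A> \<Longrightarrow> T \<subseteq> E m \<and> card T = k"
  shows "sperner_system (E m) \<A>"
proof -
  have "S = T" if "S \<in> \<A>" "T \<in> \<A>" "S \<subseteq> T" for S T
  proof (rule card_subset_eq)
    show "finite T"
      using assms[OF that(2)] finite_E finite_subset by blast
    show "card S = card T"
      using assms that by metis
  qed (fact that(3))
  then show ?thesis
    using assms finite_E unfolding sperner_system_def set_system_def by blast
qed

lemma S_systems_sperner:
  assumes "odd m" "m \<ge> 3"
  shows "sperner_system (E m) (S1_system m)" "sperner_system (E m) (S2_system m)"
proof -
  show "sperner_system (E m) (S1_system m)"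
  proof (rule uniform_sperner)
    show "T \<subseteq> E m \<and> card T = m" if "T \<in> S1_system m" for T
      using that H_system_uniform[OF assms] F_set_uniform
      unfolding S1_system_def F1_system_def by blast
  qed
  show "sperner_system (E m) (S2_system m)"
  proof (rule uniform_sperner)
    show "T \<subseteq> E m \<and> card T = m" if "T \<in> S2_system m" for T
      using that H_system_uniform[OF assms] F_set_uniform
      unfolding S2_system_def F2_system_def by blast
  qed
qed

end

theory Submission
  imports Defs "HOL-Combinatorics.Transposition"
begin

text \<open>Count the blocks that contain a given element. Away from the orbits of \<open>A_block m\<close> and
  \<open>B_block m\<close>, the exchange of \<open>j\<close> and \<open>j'\<close> is a symmetry of the brackets, and the
  transversals of either parity are split evenly between \<open>j\<close> and \<open>j'\<close>. A block
  in the orbit of \<open>A_block m\<close> or \<open>B_block m\<close> that contains \<open>j'\<close> also contains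
  \<open>j\<close>, and not conversely. Hence every unprimed element lies in more blocks than every
  primed one, and an isomorphism has to preserve the set of unprimed elements. That set
  is a transversal of odd index size, so it is a block of the first system but not of the second.\<close>

section \<open>Degrees of elements and their behaviour under maps of blocks\<close>

definition degree :: "'a set set \<Rightarrow> 'a \<Rightarrow> nat" where
  "degree \<A> e = card {S \<in> \<A>. e \<in> S}"

lemma degree_Un:
  assumes "finite \<A>" "finite \<B>" "\<A> \<inter> \<B> = {}"
  shows "degree (\<A> \<union> \<B>) e = degree \<A> e + degree \<B> e"
proof -
  have "{S \<in> \<A> \<union> \<B>. e \<in> S} = {S \<in> \<A>. e \<in> S} \<union> {S \<in> \<B>. e \<in> S}"
    by blast
  then show ?thesis
    unfolding degree_def
    using assms card_Un_disjoint[of "{S \<in> \<A>. e \<in> S}" "{S \<in> \<B>. e \<in> S}"] by auto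
qed

text \<open>Taking images under \<open>f\<close> is injective on subsets of \<open>A\<close>, so it
  embeds the blocks through \<open>e\<close> into the blocks through \<open>f e\<close>. Equalities
  of degrees come from applying this in two directions, so no surjectivity has to be
  checked.\<close>

lemma degree_le_image:
  assumes "inj_on f A" "\<A> \<subseteq> Pow A" "finite \<B>" "e \<in> A" "\<And>S. S \<in> \<A> \<Longrightarrow> f ` S \<in> \<B>"
  shows "degree \<A> e \<le> degree \<B> (f e)"
  unfolding degree_def
proof (rule card_inj_on_le)
  show "inj_on ((`) f) {S \<in> \<A>. e \<in> S}"
    by (rule inj_on_subset[OF inj_on_image_Pow[OF assms(1)]]) (use assms(2) in blast)
  show "(`) f ` {S \<in> \<A>. e \<in> S} \<subseteq> {S \<in> \<B>. f e \<in> S}"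
    using assms(5) by blast
  show "finite {S \<in> \<B>. f e \<in> S}"
    using assms(3) by simp
qed

lemma degree_isomorphism:
  assumes "bij_betw \<sigma> A B" "{\<sigma> ` S | S. S \<in> \<A>} = \<B>" "\<A> \<subseteq> Pow A" "e \<in> A"
  shows "degree \<B> (\<sigma> e) = degree \<A> e"
proof -
  have inj: "inj_on \<sigma> A"
    using assms(1) by (rule bij_betw_imp_inj_on)
  have "\<sigma> e \<in> \<sigma> ` S \<longleftrightarrow> e \<in> S" if "S \<in> \<A>" for S
    using inj_on_image_mem_iff[OF inj assms(4)] assms(3) that by auto
  then have "{T \<in> \<B>. \<sigma> e \<in> T} = (`) \<sigma> ` {S \<in> \<A>. e \<in> S}"
    unfolding assms(2)[symmetric] by (auto simp: image_iff)
  moreover have "inj_on ((`) \<sigma>) {S \<in> \<A>. e \<in> S}"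
    by (rule inj_on_subset[OF inj_on_image_Pow[OF inj]]) (use assms(3) in blast)
  ultimately show ?thesis
    by (simp add: degree_def card_image)
qed

lemma degree_transpose:
  assumes "finite \<A>" "\<And>S. S \<in> \<A> \<Longrightarrow> transpose a b ` S \<in> \<A>"
  shows "degree \<A> a = degree \<A> b"
proof -
  have "degree \<A> e \<le> degree \<A> (transpose a b e)" for e
    using assms by (intro degree_le_image[of _ UNIV]) auto
  from this[of a] this[of b] show ?thesis
    by simp
qed

section \<open>Cyclic addition, shifts and powers of the rotation\<close>

lemma cadd_cadd: "x \<ge> 1 \<Longrightarrow> cadd m (cadd m x p) q = cadd m x (p + q)"
  by (simp add: cadd_def mod_add_left_eq add.assoc)

text \<open>Arbitrary multiples of \<open>m\<close> make it possible to undo a shift by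
  \<open>i\<close> with the natural number \<open>m * i - i\<close>, so inverse rotations are again
  powers of \<open>rho m\<close>.\<close>

lemma cadd_mult: "x \<in> {1..m} \<Longrightarrow> cadd m x (m * k) = x"
proof -
  assume x: "x \<in> {1..m}"
  then have "x + m * k - 1 = x - 1 + m * k"
    by simp
  then have "cadd m x (m * k) = (x - 1) mod m + 1"
    unfolding cadd_def by (metis mod_mult_self2)
  with x show ?thesis
    by auto
qed

lemma cadd_image: "(\<lambda>x. cadd m x q) ` {1..m} = {1..m}"
proof (cases "m = 0")
  case False
  then show ?thesis
    using cadd_in[of m _ q] by (intro endo_inj_surj[OF _ _ inj_on_cadd]) auto
qed simp

text \<open>Orbits are built from exponents in \<open>{1..m}\<close>, while sums of shifts give
  arbitrary natural numbers; this brings the latter back into range.\<close>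

lemma cadd_reduce:
  assumes "m \<ge> 1"
  obtains r where "r \<in> {1..m}" "\<And>x. x \<ge> 1 \<Longrightarrow> cadd m x q = cadd m x r"
proof
  \<comment> \<open>The representative of \<open>q\<close> in \<open>{1..m}\<close>. Adding
    \<open>m\<close> keeps the subtraction in \<open>cadd\<close> from truncating at
    \<open>q = 0\<close>, where the representative is \<open>m\<close>.\<close>
  show "cadd m q m \<in> {1..m}"
    using assms by (rule cadd_in)
  fix x :: nat
  assume "x \<ge> 1"
  then have "cadd m x (cadd m q m) = (x + (q + m - 1) mod m) mod m + 1"
    by (simp add: cadd_def)
  also have "\<dots> = (x + q - 1 + m) mod m + 1"
    using assms \<open>x \<ge> 1\<close> by (simp add: mod_add_right_eq add_ac)
  finally show "cadd m x q = cadd m x (cadd m q m)"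
    by (simp add: cadd_def)
qed

lemma shift_eq_image: "shift m X q = (\<lambda>x. cadd m x q) ` X"
  by (auto simp: shift_def)

lemma shift_shift: "X \<subseteq> {1..m} \<Longrightarrow> shift m (shift m X p) q = shift m X (p + q)"
  unfolding shift_eq_image image_image by (rule image_cong) (auto simp: cadd_cadd)

lemma shift_mult: "X \<subseteq> {1..m} \<Longrightarrow> shift m X (m * k) = X"
  using image_cong[of X X "\<lambda>x. cadd m x (m * k)" id] cadd_mult[of _ m k]
  by (auto simp: shift_eq_image subset_iff)

lemma shift_complement:
  assumes "X \<subseteq> {1..m}"
  shows "shift m ({1..m} - X) q = {1..m} - shift m X q"
  unfolding shift_eq_image
  using inj_on_image_set_diff[OF inj_on_cadd[of m q], of "{1..m}" X] assms cadd_image by auto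

lemma shift_subset: "X \<subseteq> {1..m} \<Longrightarrow> shift m X q \<subseteq> {1..m}"
  unfolding shift_eq_image using cadd_image[of m q] by blast

lemma card_shift: "X \<subseteq> {1..m} \<Longrightarrow> card (shift m X q) = card X"
  unfolding shift_eq_image by (intro card_image inj_on_subset[OF inj_on_cadd])

lemma rho_pow_apply:
  assumes "e \<in> E m"
  shows "(rho m ^^ i) e = map_sum (\<lambda>x. cadd m x i) (\<lambda>x. cadd m x i) e"
proof (induction i)
  case 0
  show ?case
    using assms cadd_mult[of _ m 0] by (auto simp: E_def)
next
  case (Suc i)
  then show ?case
    using assms by (auto simp: E_def rho_def cadd_cadd)
qed

lemma rho_pow_mult: "T \<subseteq> E m \<Longrightarrow> (rho m ^^ (m * k)) ` T = T"
proof -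
  assume T: "T \<subseteq> E m"
  have "(rho m ^^ (m * k)) e = e" if "e \<in> T" for e
    using that T cadd_mult[of _ m k] by (subst rho_pow_apply) (auto simp: E_def)
  then show ?thesis
    by simp
qed

lemma rho_pow_image_iff:
  assumes "T \<subseteq> E m" "x \<in> {1..m}"
  shows "Inl (cadd m x i) \<in> (rho m ^^ i) ` T \<longleftrightarrow> Inl x \<in> T"
    and "Inr (cadd m x i) \<in> (rho m ^^ i) ` T \<longleftrightarrow> Inr x \<in> T"
proof -
  have "Inl x \<in> E m" "Inr x \<in> E m"
    using assms(2) by (auto simp: E_def)
  then show "Inl (cadd m x i) \<in> (rho m ^^ i) ` T \<longleftrightarrow> Inl x \<in> T"
    "Inr (cadd m x i) \<in> (rho m ^^ i) ` T \<longleftrightarrow> Inr x \<in> T"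
    using inj_on_image_mem_iff[OF conjunct1[OF rho_pow[of i m]] _ assms(1)]
    by (metis rho_pow_apply map_sum.simps)+
qed

lemma rho_orbit_system:
  assumes "\<A> \<subseteq> Pow (E m)" "T \<in> orbit_system m \<A>"
  shows "rho m ` T \<in> orbit_system m \<A>"
proof -
  obtain i S where i: "i \<in> {1..m}" and S: "S \<in> \<A>" "T = (rho m ^^ i) ` S"
    using assms(2) by (auto simp: orbit_system_def)
  have T: "rho m ` T = (rho m ^^ Suc i) ` S"
    by (simp add: S(2) image_comp)
  \<comment> \<open>Exponents run through \<open>{1..m}\<close>, so the successor of
    \<open>m\<close> must be replaced by 1; the \<open>m\<close>-th power of \<open>rho m\<close>
    fixes every subset of \<open>E m\<close>.\<close>
  show ?thesis
  proof (cases "i = m")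
    case True
    have "rho m ` T = (rho m ^^ 1) ` S"
      using rho_pow_mult[of S m 1] assms(1) S True by auto
    moreover have "1 \<in> {1..m}"
      using i by simp
    ultimately show ?thesis
      unfolding orbit_system_def using S(1) by blast
  next
    case False
    then have "Suc i \<in> {1..m}"
      using i by simp
    then show ?thesis
      unfolding orbit_system_def using S(1) T by blast
  qed
qed

section \<open>Doubled and missing indices, brackets and their orbits\<close>

definition doubles :: "nat \<Rightarrow> (nat + nat) set \<Rightarrow> nat set" where
  "doubles m T = {x \<in> {1..m}. Inl x \<in> T \<and> Inr x \<in> T}"

definition gaps :: "nat \<Rightarrow> (nat + nat) set \<Rightarrow> nat set" where
  "gaps m T = {x \<in> {1..m}. Inl x \<notin> T \<and> Inr x \<notin> T}"

text \<open>A bracket prescribes how many of the two copies of each index are present, so it is a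
  fibre of the map sending a block to its pair of \<open>doubles\<close> and \<open>gaps\<close>.
  Questions about brackets thus become questions about this pair.\<close>

lemma bracket_iff:
  assumes "X \<subseteq> {1..m}" "Y \<subseteq> {1..m}" "X \<inter> Y = {}"
  shows "T \<in> bracket m X Y \<longleftrightarrow> T \<subseteq> E m \<and> doubles m T = X \<and> gaps m T = Y"
proof -
  have c: "card ({Inl x, Inr x} \<inter> T) = of_bool (Inl x \<in> T) + of_bool (Inr x \<in> T)"
    for x :: nat
    by (auto simp: Int_insert_left)
  show ?thesis
    unfolding bracket_def doubles_def gaps_def mem_Collect_eq c
    using assms by (auto simp: of_bool_def split: if_splits)
qed

lemma doubles_gaps_rho_pow:
  assumes "T \<subseteq> E m"
  shows "doubles m ((rho m ^^ i) ` T) = shift m (doubles m T) i"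
    and "gaps m ((rho m ^^ i) ` T) = shift m (gaps m T) i"
proof -
  \<comment> \<open>Reindexes a subset of \<open>{1..m}\<close> along the permutation given by the
    shift by \<open>i\<close>.\<close>
  have *: "{y \<in> {1..m}. P y} = (\<lambda>x. cadd m x i) ` {x \<in> {1..m}. P (cadd m x i)}" for P
    by (subst (1) cadd_image[of m i, symmetric]) blast
  show "doubles m ((rho m ^^ i) ` T) = shift m (doubles m T) i"
    unfolding doubles_def shift_eq_image
    by (subst *) (use rho_pow_image_iff[OF assms] in \<open>simp cong: conj_cong\<close>)
  show "gaps m ((rho m ^^ i) ` T) = shift m (gaps m T) i"
    unfolding gaps_def shift_eq_image
    by (subst *) (use rho_pow_image_iff[OF assms] in \<open>simp cong: conj_cong\<close>)
qed

text \<open>Rotating a block shifts its pair of \<open>doubles\<close> and \<open>gaps\<close>;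
  conversely, a block whose pair is a shift of \<open>(X, Y)\<close> can be rotated back into the
  bracket. The shift \<open>q\<close> ranges over all natural numbers, so that shifts can be added
  without reduction.\<close>

lemma bracket_orbit_iff:
  assumes "m \<ge> 1" "X \<subseteq> {1..m}" "Y \<subseteq> {1..m}" "X \<inter> Y = {}"
  shows "T \<in> bracket_orbit m X Y \<longleftrightarrow>
    T \<subseteq> E m \<and> (\<exists>q. doubles m T = shift m X q \<and> gaps m T = shift m Y q)"
proof
  assume "T \<in> bracket_orbit m X Y"
  then obtain i S where S: "S \<in> bracket m X Y" "T = (rho m ^^ i) ` S"
    by (auto simp: bracket_orbit_def orbit_system_def)
  then have "S \<subseteq> E m" "doubles m S = X" "gaps m S = Y"
    using bracket_iff[OF assms(2-4)] by auto
  then show "T \<subseteq> E m \<and> (\<exists>q. doubles m T = shift m X q \<and> gaps m T = shift m Y q)"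
    using doubles_gaps_rho_pow[of S m i] rho_pow[of i m] S(2) by blast
next
  assume "T \<subseteq> E m \<and> (\<exists>q. doubles m T = shift m X q \<and> gaps m T = shift m Y q)"
  then obtain q where T: "T \<subseteq> E m" and q: "doubles m T = shift m X q" "gaps m T = shift m Y q"
    by blast
  obtain r where r: "r \<in> {1..m}" "\<And>x. x \<ge> 1 \<Longrightarrow> cadd m x q = cadd m x r"
    using cadd_reduce[OF assms(1), of q] by blast
  have shift_r: "shift m Z q = shift m Z r" if "Z \<subseteq> {1..m}" for Z
    unfolding shift_eq_image using that r(2) by (intro image_cong) auto
  \<comment> \<open>The inverse of \<open>r\<close> modulo \<open>m\<close>, chosen so that
    \<open>p + r\<close> is a multiple of \<open>m\<close>.\<close>
  define p where "p = m * r - r"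
  have p: "r + p = m * r" "p + r = m * r"
    using assms(1) by (auto simp: p_def)
  define S where "S = (rho m ^^ p) ` T"
  have "S \<subseteq> E m"
    unfolding S_def using T rho_pow[of p m] by blast
  moreover have "doubles m S = X" "gaps m S = Y"
    unfolding S_def using doubles_gaps_rho_pow[OF T, of p] q shift_r assms(2,3)
    by (simp_all add: shift_shift shift_mult p)
  ultimately have "S \<in> bracket m X Y"
    using bracket_iff[OF assms(2-4)] by blast
  moreover have "(rho m ^^ r) ` S = T"
    unfolding S_def image_comp funpow_add[symmetric] p using T by (rule rho_pow_mult)
  ultimately show "T \<in> bracket_orbit m X Y"
    unfolding bracket_orbit_def orbit_system_def using r(1) by blast
qed

text \<open>A common block makes some shift of \<open>(X, Y)\<close> equal to some shift of
  \<open>(X', Y')\<close>, so both pairs have the same shifts. By symmetry, bracket orbits that meet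
  are equal.\<close>

lemma bracket_orbit_subset_if_meets:
  assumes "m \<ge> 1" and XY: "X \<subseteq> {1..m}" "Y \<subseteq> {1..m}" "X \<inter> Y = {}"
    and XY': "X' \<subseteq> {1..m}" "Y' \<subseteq> {1..m}" "X' \<inter> Y' = {}"
    and "T \<in> bracket_orbit m X Y" "T \<in> bracket_orbit m X' Y'"
  shows "bracket_orbit m X Y \<subseteq> bracket_orbit m X' Y'"
proof
  note iff = bracket_orbit_iff[OF assms(1) XY] and iff' = bracket_orbit_iff[OF assms(1) XY']
  obtain p q where eq: "shift m X p = shift m X' q" "shift m Y p = shift m Y' q"
    using assms(8,9) iff iff' by metis
  fix U
  assume "U \<in> bracket_orbit m X Y"
  then obtain r where U: "U \<subseteq> E m" "doubles m U = shift m X r" "gaps m U = shift m Y r"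
    using iff by blast
  \<comment> \<open>After a shift by \<open>p\<close>, the amount \<open>m * p - p\<close> leads
    back to the start and \<open>r\<close> then leads to the pair of \<open>U\<close>; the same
    route is followed from the shift of \<open>(X', Y')\<close> by \<open>q\<close>.\<close>
  have move: "shift m Z r = shift m Z' (q + (m * p - p + r))"
    if "Z \<subseteq> {1..m}" "Z' \<subseteq> {1..m}" "shift m Z p = shift m Z' q" for Z Z'
  proof -
    have "p \<le> m * p"
      using assms(1) by simp
    then have "p + (m * p - p + r) = m * p + r"
      by linarith
    then have "shift m (shift m Z p) (m * p - p + r) = shift m (shift m Z (m * p)) r"
      using that(1) by (simp only: shift_shift)
    then show ?thesis
      using that by (simp add: shift_shift shift_mult)
  qed
  show "U \<in> bracket_orbit m X' Y'"
    unfolding iff' using U move eq XY XY' by metis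
qed

text \<open>The exchange alters a set only if it contains exactly one of \<open>Inl j\<close> and
  \<open>Inr j\<close>, and afterwards it still contains exactly one. This is what makes brackets
  symmetric in the two copies.\<close>

lemma doubles_gaps_transpose:
  "doubles m (transpose (Inl j) (Inr j) ` T) = doubles m T"
  "gaps m (transpose (Inl j) (Inr j) ` T) = gaps m T"
proof -
  show "doubles m (transpose (Inl j) (Inr j) ` T) = doubles m T"
    "gaps m (transpose (Inl j) (Inr j) ` T) = gaps m T"
    unfolding doubles_def gaps_def by (auto simp: in_transpose_image_iff transpose_def split: if_splits)
qed

section \<open>Transversals of a given parity\<close>

lemma F_set_doubles_gaps: "J \<subseteq> {1..m} \<Longrightarrow> doubles m (F_set m J) = {} \<and> gaps m (F_set m J) = {}"
  by (auto simp: F_set_def doubles_def gaps_def)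

text \<open>The parity is a Boolean parameter, \<open>True\<close> for even, so that both systems
  are handled by the same lemmas.\<close>

definition F_system :: "bool \<Rightarrow> nat \<Rightarrow> (nat + nat) set set" where
  "F_system p m = {F_set m J | J. J \<subseteq> {1..m} \<and> even (card J) = p}"

lemma F1_F2_eq: "F1_system m = F_system False m" "F2_system m = F_system True m"
  by (auto simp: F1_system_def F2_system_def F_system_def)

lemma F_system_subset: "F_system p m \<subseteq> Pow (E m)"
  using F_set_uniform by (auto simp: F_system_def)

lemma rho_F_system:
  assumes "T \<in> F_system p m"
  shows "rho m ` T \<in> F_system p m"
proof -
  obtain J where J: "J \<subseteq> {1..m}" "even (card J) = p" "T = F_set m J"
    using assms by (auto simp: F_system_def)
  have "rho m ` T = F_set m (shift m J 1)"
    unfolding J(3) F_set_def shift_complement[OF J(1), symmetric]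
    by (simp add: rho_def image_Un image_image shift_eq_image)
  then show ?thesis
    unfolding F_system_def using J card_shift[OF J(1), of 1] shift_subset[OF J(1), of 1] by auto
qed

text \<open>Exchanging the copies of \<open>j\<close> alone would flip the parity of the index set,
  so the copies of a second index \<open>k\<close> are exchanged as well. The double exchange
  preserves the family and swaps \<open>Inl j\<close> with \<open>Inr j\<close>.\<close>

lemma F_system_degree:
  assumes "j \<in> {1..m}" "m \<ge> 2"
  shows "degree (F_system p m) (Inl j) = degree (F_system p m) (Inr j)"
proof -
  obtain k where k: "k \<in> {1..m}" "k \<noteq> j"
  proof
    show "(if j = 1 then 2 else 1) \<in> {1..m}" "(if j = 1 then 2 else 1) \<noteq> j"
      using assms by auto
  qed
  let ?f = "transpose (Inl j) (Inr j) \<circ> transpose (Inl k) (Inr k) :: nat + nat \<Rightarrow> nat + nat"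
  have closed: "?f ` T \<in> F_system p m" if "T \<in> F_system p m" for T
  proof -
    obtain J where J: "J \<subseteq> {1..m}" "even (card J) = p" "T = F_set m J"
      using \<open>T \<in> F_system p m\<close> by (auto simp: F_system_def)
    have fin: "finite J"
      using J(1) finite_subset by blast
    \<comment> \<open>The symmetric difference of \<open>J\<close> and \<open>{j, k}\<close>: each
      exchange toggles the membership of its index.\<close>
    let ?K = "(J - {j, k}) \<union> ({j, k} - J)"
    have inv: "a \<in> ?f ` T \<longleftrightarrow> transpose (Inl k) (Inr k) (transpose (Inl j) (Inr j) a) \<in> T" for a
      unfolding image_comp[symmetric] in_transpose_image_iff ..
    have "?f ` T = F_set m ?K"
    proof (intro set_eqI)
      fix a
      show "a \<in> ?f ` T \<longleftrightarrow> a \<in> F_set m ?K"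
      proof (cases "a \<in> {Inl j, Inr j, Inl k, Inr k}")
        case True
        then show ?thesis
          unfolding inv unfolding J(3) F_set_def using k assms(1)
          by (elim insertE emptyE) (simp_all add: image_iff)
      next
        case False
        then have "transpose (Inl k) (Inr k) (transpose (Inl j) (Inr j) a) = a"
          by simp
        with False show ?thesis
          unfolding inv unfolding J(3) F_set_def by (cases a) (simp_all add: image_iff)
      qed
    qed
    moreover have "even (card ?K) = p"
    proof -
      have "card ?K = card (J - {j, k}) + card ({j, k} - J)"
        using fin by (intro card_Un_disjoint) auto
      moreover have "card J = card (J - {j, k}) + card (J \<inter> {j, k})"
        using fin by (metis add.commute card_Int_Diff)
      moreover have "card ({j, k} - J) + card (J \<inter> {j, k}) = 2"
        using k(2) card_Int_Diff[of "{j, k}" J] by (simp add: Int_commute)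
      ultimately have "card ?K + card J = 2 * (card (J - {j, k}) + 1)"
        by presburger
      then have "even (card ?K + card J)"
        by simp
      then show ?thesis
        using J(2) by auto
    qed
    moreover have "?K \<subseteq> {1..m}"
      using J(1) k(1) assms(1) by auto
    ultimately show ?thesis
      by (auto simp: F_system_def)
  qed
  have "finite (F_system p m)"
    using F_system_subset finite_E by (meson finite_Pow_iff finite_subset)
  then have "degree (F_system p m) e \<le> degree (F_system p m) (?f e)" for e
    using closed by (intro degree_le_image[of ?f UNIV]) (auto intro!: inj_compose)
  from this[of "Inl j"] this[of "Inr j"] show ?thesis
    using k(2) by (simp add: transpose_def)
qed

section \<open>The two families that make up \<open>H_system m\<close>\<close>

definition AB_system :: "nat \<Rightarrow> (nat + nat) set set" where
  "AB_system m = orbit_system m {A_block m, B_block m}"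

definition G_system :: "nat \<Rightarrow> (nat + nat) set set" where
  "G_system m = \<Union>{Q \<in> Omega m - {bracket_orbit m (C_set m) (shift m (C_set m) 1),
                       bracket_orbit m (shift m (C_set m) 1) (C_set m)}.
         orbit_signature m Q = {Beta}}"

lemma H_system_eq: "H_system m = AB_system m \<union> G_system m"
  by (simp add: H_system_def AB_system_def G_system_def)

text \<open>The family is a union of whole bracket orbits, so each block brings its entire orbit
  along, and symmetries of bracket orbits carry over to \<open>G_system m\<close>.\<close>

lemma G_systemE:
  assumes "T \<in> G_system m"
  obtains X Y where "X \<subseteq> {1..m}" "Y \<subseteq> {1..m}" "card X = card Y" "X \<inter> Y = {}" "X \<noteq> {}"
    "T \<in> bracket_orbit m X Y" "bracket_orbit m X Y \<subseteq> G_system m"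
    "bracket_orbit m X Y \<noteq> bracket_orbit m (C_set m) (shift m (C_set m) 1)"
    "bracket_orbit m X Y \<noteq> bracket_orbit m (shift m (C_set m) 1) (C_set m)"
proof -
  obtain Q where Q: "T \<in> Q" "Q \<in> Omega m" "Q \<subseteq> G_system m"
    "Q \<noteq> bracket_orbit m (C_set m) (shift m (C_set m) 1)"
    "Q \<noteq> bracket_orbit m (shift m (C_set m) 1) (C_set m)"
    using assms unfolding G_system_def by blast
  from Q(2) obtain X Y where XY: "X \<subseteq> {1..m}" "Y \<subseteq> {1..m}" "card X = card Y" "X \<inter> Y = {}"
    "Q = bracket_orbit m X Y" "Q \<noteq> bracket_orbit m {} {}"
    by (auto simp: Omega_def)
  \<comment> \<open>If \<open>X\<close> were empty, equal cardinalities would make \<open>Y\<close>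
    empty too, giving the orbit that \<open>Omega m\<close> leaves out.\<close>
  moreover have "X \<noteq> {}"
    using XY finite_subset[of Y "{1..m}"] by auto
  ultimately show ?thesis
    using that[of X Y] Q by blast
qed

context
  fixes m :: nat
  assumes odd_m: "odd m" and m3: "m \<ge> 3"
begin

text \<open>Since \<open>m\<close> is odd, \<open>{1..m}\<close> splits into the odd numbers up to
  \<open>m - 2\<close>, their successors, which are the even numbers up to \<open>m - 1\<close>, and
  \<open>m\<close> itself.\<close>

lemma C_set_props:
  "C_set m \<subseteq> {1..m}" "shift m (C_set m) 1 \<subseteq> {1..m}" "C_set m \<inter> shift m (C_set m) 1 = {}"
  "m \<notin> C_set m" "m \<notin> shift m (C_set m) 1"
  "{1..m} = insert m (C_set m \<union> shift m (C_set m) 1)" "C_set m \<noteq> {}"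
proof -
  note s = shift_C_set[OF m3]
  show "C_set m \<subseteq> {1..m}" "m \<notin> C_set m"
    using m3 by (auto simp: C_set_def)
  show "shift m (C_set m) 1 \<subseteq> {1..m}" "m \<notin> shift m (C_set m) 1"
    "C_set m \<inter> shift m (C_set m) 1 = {}"
    using m3 odd_m unfolding s by (auto simp: C_set_def)
  have "1 \<in> C_set m"
    using m3 by (simp add: C_set_def)
  then show "C_set m \<noteq> {}"
    by blast
  show "{1..m} = insert m (C_set m \<union> shift m (C_set m) 1)"
  proof
    show "insert m (C_set m \<union> shift m (C_set m) 1) \<subseteq> {1..m}"
      using m3 unfolding s by (auto simp: C_set_def)
    show "{1..m} \<subseteq> insert m (C_set m \<union> shift m (C_set m) 1)"
    proof
      fix x
      assume x: "x \<in> {1..m}"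
      show "x \<in> insert m (C_set m \<union> shift m (C_set m) 1)"
      proof (cases "odd x")
        case True
        then have "x \<noteq> m - 1"
          using odd_m by auto
        then show ?thesis
          using True x by (auto simp: C_set_def)
      next
        case False
        then have "x \<noteq> m"
          using odd_m by auto
        with x False have "x - 1 \<in> C_set m" "x = Suc (x - 1)"
          by (auto simp: C_set_def)
        then show ?thesis
          unfolding s by blast
      qed
    qed
  qed
qed

lemma AB_in_brackets:
  "A_block m \<in> bracket m (shift m (C_set m) 1) (C_set m)"
  "B_block m \<in> bracket m (C_set m) (shift m (C_set m) 1)"
proof -
  note C = C_set_props
  have "doubles m (A_block m) = shift m (C_set m) 1" "gaps m (A_block m) = C_set m"
    "doubles m (B_block m) = C_set m" "gaps m (B_block m) = shift m (C_set m) 1"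
    unfolding doubles_def gaps_def A_block_def B_block_def using C by blast+
  then show "A_block m \<in> bracket m (shift m (C_set m) 1) (C_set m)"
    "B_block m \<in> bracket m (C_set m) (shift m (C_set m) 1)"
    using AB_blocks[OF odd_m m3] C bracket_iff by (simp_all add: Int_commute)
qed

lemma AB_systemE:
  assumes "T \<in> AB_system m"
  obtains X Y where "X \<subseteq> {1..m}" "Y \<subseteq> {1..m}" "X \<inter> Y = {}" "X \<noteq> {}" "T \<in> bracket_orbit m X Y"
    "(X, Y) \<in> {(C_set m, shift m (C_set m) 1), (shift m (C_set m) 1, C_set m)}"
proof -
  have "T \<in> bracket_orbit m (C_set m) (shift m (C_set m) 1)
    \<or> T \<in> bracket_orbit m (shift m (C_set m) 1) (C_set m)"
    using assms AB_in_brackets unfolding AB_system_def bracket_orbit_def orbit_system_def by blast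
  moreover have "shift m (C_set m) 1 \<noteq> {}"
    using C_set_props by (simp add: shift_eq_image)
  ultimately show ?thesis
    using that C_set_props by (metis Int_commute insertCI)
qed

text \<open>The rotations of \<open>A_block m\<close> and \<open>B_block m\<close> lie in exactly
  the two bracket orbits excluded from \<open>G_system m\<close>, and distinct bracket orbits are
  disjoint.\<close>

lemma AB_G_disjoint: "AB_system m \<inter> G_system m = {}"
proof (rule ccontr)
  assume "AB_system m \<inter> G_system m \<noteq> {}"
  then obtain T where T: "T \<in> AB_system m" "T \<in> G_system m"
    by blast
  have m1: "m \<ge> 1"
    using m3 by simp
  from T(1) obtain X Y where XY: "X \<subseteq> {1..m}" "Y \<subseteq> {1..m}" "X \<inter> Y = {}" "T \<in> bracket_orbit m X Y"
    and C: "(X, Y) \<in> {(C_set m, shift m (C_set m) 1), (shift m (C_set m) 1, C_set m)}"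
    by (rule AB_systemE)
  from T(2) obtain X' Y' where XY': "X' \<subseteq> {1..m}" "Y' \<subseteq> {1..m}" "X' \<inter> Y' = {}"
    "T \<in> bracket_orbit m X' Y'"
    and C': "bracket_orbit m X' Y' \<noteq> bracket_orbit m (C_set m) (shift m (C_set m) 1)"
    "bracket_orbit m X' Y' \<noteq> bracket_orbit m (shift m (C_set m) 1) (C_set m)"
    by (rule G_systemE)
  have "bracket_orbit m X Y = bracket_orbit m X' Y'"
    using bracket_orbit_subset_if_meets[OF m1] XY XY' by (metis subset_antisym)
  then show False
    using C C' by auto
qed

text \<open>Every block lies in a bracket orbit with nonempty \<open>X\<close>. This separates
  \<open>H_system m\<close> from the transversals, which have no doubled index.\<close>

lemma H_system_doubles:
  assumes "T \<in> H_system m"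
  shows "doubles m T \<noteq> {}"
proof -
  obtain X Y where XY: "X \<subseteq> {1..m}" "Y \<subseteq> {1..m}" "X \<inter> Y = {}" "X \<noteq> {}" "T \<in> bracket_orbit m X Y"
    using assms unfolding H_system_eq by (metis UnE AB_systemE G_systemE)
  then show ?thesis
    using bracket_orbit_iff[of m X Y T] m3 by (auto simp: shift_eq_image)
qed

lemma H_F_disjoint: "H_system m \<inter> F_system p m = {}"
proof -
  have "doubles m T = {}" if "T \<in> F_system p m" for T
    using that F_set_doubles_gaps by (auto simp: F_system_def)
  then show ?thesis
    using H_system_doubles by blast
qed

lemma H_system_subset: "H_system m \<subseteq> Pow (E m)"
  using H_system_uniform[OF odd_m m3] by blast

lemma finite_systems: "finite (AB_system m)" "finite (G_system m)" "finite (F_system p m)"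
proof -
  have "finite \<A>" if "\<A> \<subseteq> Pow (E m)" for \<A>
    using that finite_E finite_subset by blast
  then show "finite (AB_system m)" "finite (G_system m)" "finite (F_system p m)"
    using H_system_subset F_system_subset[of p m] by (simp_all add: H_system_eq)
qed

section \<open>Comparison of the degrees of the two copies of an index\<close>

lemma G_system_degree:
  assumes "j \<in> {1..m}"
  shows "degree (G_system m) (Inl j) = degree (G_system m) (Inr j)"
proof (rule degree_transpose[OF finite_systems(2)])
  fix T
  assume "T \<in> G_system m"
  then obtain X Y where XY: "X \<subseteq> {1..m}" "Y \<subseteq> {1..m}" "X \<inter> Y = {}"
    and T: "T \<in> bracket_orbit m X Y" and sub: "bracket_orbit m X Y \<subseteq> G_system m"
    by (rule G_systemE)
  have "transpose (Inl j) (Inr j) ` T \<subseteq> E m" if "T \<subseteq> E m"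
    using that assms by (auto simp: E_def transpose_def)
  then have "transpose (Inl j) (Inr j) ` T \<in> bracket_orbit m X Y"
    using T bracket_orbit_iff[OF _ XY] m3 doubles_gaps_transpose[of m j T] by simp
  then show "transpose (Inl j) (Inr j) ` T \<in> G_system m"
    using sub by blast
qed

text \<open>In \<open>A_block m\<close> and \<open>B_block m\<close> each index other than
  \<open>m\<close> is doubled or missing, and \<open>m\<close> occurs only unprimed. Rotations keep
  this pattern, so blocks through \<open>Inr j\<close> also pass through
  \<open>Inl j\<close>.\<close>

lemma AB_system_degree:
  assumes "j \<in> {1..m}"
  shows "degree (AB_system m) (Inr j) < degree (AB_system m) (Inl j)"
  unfolding degree_def
proof (rule psubset_card_mono)
  show "finite {S \<in> AB_system m. Inl j \<in> S}"
    using finite_systems by simp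
  have "Inl j \<in> T" if "T \<in> AB_system m" "Inr j \<in> T" for T
  proof -
    obtain i S where S: "S \<in> {A_block m, B_block m}" "T = (rho m ^^ i) ` S"
      using \<open>T \<in> AB_system m\<close> by (auto simp: AB_system_def orbit_system_def)
    then have "S \<subseteq> E m"
      using AB_blocks[OF odd_m m3] by auto
    moreover obtain x where "x \<in> {1..m}" "j = cadd m x i"
      using assms cadd_image[of m i] by blast
    moreover have "Inr x \<in> S \<Longrightarrow> Inl x \<in> S" for x
      using S(1) by (auto simp: A_block_def B_block_def)
    ultimately show ?thesis
      using rho_pow_image_iff[of S m] that(2) S(2) by blast
  qed
  then have "{S \<in> AB_system m. Inr j \<in> S} \<subseteq> {S \<in> AB_system m. Inl j \<in> S}"
    by blast
  \<comment> \<open>Strictness: rotation by \<open>j\<close> carries the index \<open>m\<close>,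
    present only unprimed in \<open>A_block m\<close>, to \<open>j\<close>.\<close>
  moreover define T where "T = (rho m ^^ j) ` A_block m"
  have "T \<in> AB_system m"
    using assms unfolding T_def AB_system_def orbit_system_def by blast
  moreover have "Inl j \<in> T" "Inr j \<notin> T"
  proof -
    have "j = cadd m m j"
      using assms by (auto simp: cadd_def Suc_diff_le mod_if)
    moreover have "A_block m \<subseteq> E m" "m \<in> {1..m}"
      using AB_blocks[OF odd_m m3] m3 by auto
    moreover have "Inl m \<in> A_block m" "Inr m \<notin> A_block m"
      using C_set_props(5) by (auto simp: A_block_def)
    ultimately show "Inl j \<in> T" "Inr j \<notin> T"
      unfolding T_def using rho_pow_image_iff[of "A_block m" m m j] by metis+
  qed
  ultimately show "{S \<in> AB_system m. Inr j \<in> S} \<subset> {S \<in> AB_system m. Inl j \<in> S}"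
    by blast
qed

text \<open>Degrees add up over the three disjoint families; two of them contribute equally to both
  copies, and \<open>AB_system m\<close> decides the comparison.\<close>

lemma degree_less:
  assumes "j \<in> {1..m}"
  shows "degree (H_system m \<union> F_system p m) (Inr j) < degree (H_system m \<union> F_system p m) (Inl j)"
proof -
  have "degree (H_system m \<union> F_system p m) e =
    degree (AB_system m) e + degree (G_system m) e + degree (F_system p m) e" for e
    using H_F_disjoint[of p] AB_G_disjoint finite_systems unfolding H_system_eq
    by (simp add: degree_Un)
  then show ?thesis
    using AB_system_degree[OF assms] G_system_degree[OF assms] F_system_degree[OF assms, of p] m3 by simp
qed

section \<open>Invariance of degrees under rotation\<close>

lemma rho_H_system:
  assumes "T \<in> H_system m"
  shows "rho m ` T \<in> H_system m"
proof (cases "T \<in> AB_system m")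
  case True
  then show ?thesis
    using rho_orbit_system[of "{A_block m, B_block m}" m T] AB_blocks[OF odd_m m3]
    unfolding H_system_eq AB_system_def by blast
next
  case False
  then have "T \<in> G_system m"
    using assms by (simp add: H_system_eq)
  then obtain X Y where "T \<in> bracket_orbit m X Y" "bracket_orbit m X Y \<subseteq> G_system m"
    by (rule G_systemE)
  moreover have "bracket m X Y \<subseteq> Pow (E m)"
    by (auto simp: bracket_def)
  ultimately show ?thesis
    using rho_orbit_system unfolding H_system_eq bracket_orbit_def by blast
qed

text \<open>Rotation maps blocks to blocks, so degrees cannot decrease along it; since further
  rotation returns to \<open>e\<close>, they cannot increase either.\<close>

lemma degree_rotation:
  assumes "e \<in> E m"
  shows "degree (H_system m \<union> F_system p m) ((rho m ^^ i) e) = degree (H_system m \<union> F_system p m) e"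
proof -
  let ?S = "H_system m \<union> F_system p m"
  let ?d = "degree ?S"
  have step: "?d e \<le> ?d (rho m e)" if "e \<in> E m" for e
  proof (rule degree_le_image[OF inj_on_rho])
    show "?S \<subseteq> Pow (E m)"
      using H_system_subset F_system_subset by blast
    show "finite ?S"
      using finite_systems by (simp add: H_system_eq)
    show "rho m ` T \<in> ?S" if "T \<in> ?S" for T
      using that rho_H_system rho_F_system by blast
  qed (fact that)
  have mono: "?d e \<le> ?d ((rho m ^^ i) e)" if "e \<in> E m" for e i
  proof (induction i)
    case (Suc i)
    have "(rho m ^^ i) e \<in> E m"
      using rho_pow[of i m] that by blast
    then show ?case
      using Suc step[of "(rho m ^^ i) e"] by simp
  qed simp
  define k where "k = m * i - i"
  have "k + i = m * i"
    using m3 by (simp add: k_def)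
  then have "(rho m ^^ k) ((rho m ^^ i) e) = (rho m ^^ (m * i)) e"
    by (metis comp_apply funpow_add)
  also have "\<dots> = e"
    using rho_pow_mult[of "{e}" m i] assms by simp
  finally have "(rho m ^^ k) ((rho m ^^ i) e) = e" .
  moreover have "(rho m ^^ i) e \<in> E m"
    using rho_pow[of i m] assms by blast
  ultimately show ?thesis
    using mono[OF assms, of i] mono[of "(rho m ^^ i) e" k] by simp
qed

text \<open>Rotation by \<open>j\<close> carries \<open>m\<close> to \<open>j\<close>. Hence at most
  two degrees occur, one for unprimed and one for primed elements.\<close>

lemma degree_constant:
  assumes "j \<in> {1..m}"
  shows "degree (H_system m \<union> F_system p m) (Inl j) = degree (H_system m \<union> F_system p m) (Inl m)"
    and "degree (H_system m \<union> F_system p m) (Inr j) = degree (H_system m \<union> F_system p m) (Inr m)"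
proof -
  have "cadd m m j = j"
    using assms by (auto simp: cadd_def Suc_diff_le mod_if)
  moreover have E: "Inl m \<in> E m" "Inr m \<in> E m"
    using m3 by (auto simp: E_def)
  ultimately have "(rho m ^^ j) (Inl m) = Inl j" "(rho m ^^ j) (Inr m) = Inr j"
    by (simp_all add: rho_pow_apply)
  then show "degree (H_system m \<union> F_system p m) (Inl j) = degree (H_system m \<union> F_system p m) (Inl m)"
    "degree (H_system m \<union> F_system p m) (Inr j) = degree (H_system m \<union> F_system p m) (Inr m)"
    using degree_rotation E by metis+
qed

text \<open>The unprimed elements form the transversal with index set \<open>{1..m}\<close>, of odd
  size \<open>m\<close>. It has no doubled index, so it cannot come from
  \<open>H_system m\<close>.\<close>

lemma unprimed_block_iff: "Inl ` {1..m} \<in> H_system m \<union> F_system p m \<longleftrightarrow> \<not> p"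
proof -
  have eq: "Inl ` {1..m} = F_set m {1..m}"
    by (simp add: F_set_def)
  have "Inl ` {1..m} \<notin> H_system m"
  proof
    assume "Inl ` {1..m} \<in> H_system m"
    then have "doubles m (Inl ` {1..m}) \<noteq> {}"
      by (rule H_system_doubles)
    then show False
      by (auto simp: doubles_def)
  qed
  moreover have "J = {1..m}" if "F_set m {1..m} = F_set m J" for J
    using that by (auto simp: F_set_def)
  then have "F_set m {1..m} \<in> F_system p m \<longleftrightarrow> \<not> p"
    unfolding F_system_def using odd_m by fastforce
  ultimately show ?thesis
    unfolding eq by blast
qed

end

section \<open>Isomorphisms and the set of unprimed elements\<close>

theorem proposition3p42:
  fixes m :: nat
  assumes "odd m" and "m \<ge> 3"
  shows "\<not> isomorphic_systems (E m) (S1_system m) (E m) (S2_system m)"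
proof
  let ?S = "\<lambda>p. H_system m \<union> F_system p m"
  let ?d = "\<lambda>p. degree (?S p)"
  assume "isomorphic_systems (E m) (S1_system m) (E m) (S2_system m)"
  then obtain \<sigma> where bij: "bij_betw \<sigma> (E m) (E m)"
    and img: "{\<sigma> ` S | S. S \<in> ?S False} = ?S True"
    unfolding isomorphic_systems_def S1_system_def S2_system_def F1_F2_eq by blast
  have deg: "?d True (\<sigma> e) = ?d False e" if "e \<in> E m" for e
    using degree_isomorphism[OF bij img _ that] H_system_subset[OF assms] F_system_subset by blast
  have m: "m \<in> {1..m}"
    using assms(2) by simp
  have le: "?d p e \<le> ?d p (Inl m)" if "e \<in> E m" for p e
  proof -
    from that obtain j where "j \<in> {1..m}" "e = Inl j \<or> e = Inr j"
      by (auto simp: E_def)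
    then have "?d p e \<in> {?d p (Inl m), ?d p (Inr m)}"
      using degree_constant[OF assms, of j p] by blast
    then show ?thesis
      using degree_less[OF assms m, of p] by auto
  qed
  \<comment> \<open>The preimage \<open>e\<close> of \<open>Inl m\<close> shows that the largest
    degree of the second system also occurs in the first.\<close>
  have "Inl m \<in> \<sigma> ` E m"
    using bij m by (simp add: bij_betw_def E_def)
  then obtain e where e: "e \<in> E m" "\<sigma> e = Inl m"
    by force
  have "\<sigma> (Inl j) \<in> Inl ` {1..m}" if j: "j \<in> {1..m}" for j
  proof (rule ccontr)
    assume "\<sigma> (Inl j) \<notin> Inl ` {1..m}"
    moreover have jE: "Inl j \<in> E m"
      using j by (simp add: E_def)
    then have "\<sigma> (Inl j) \<in> E m"
      using bij_betwE[OF bij] by blast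
    ultimately obtain k where k: "k \<in> {1..m}" "\<sigma> (Inl j) = Inr k"
      unfolding E_def by blast
    \<comment> \<open>An unprimed element sent to a primed one would equate the largest degree of
      the first system with the smaller degree of the second, and \<open>e\<close> would then exceed
      that maximum.\<close>
    have "?d False (Inl m) = ?d True (Inr m)"
      using deg[OF jE] degree_constant(1)[OF assms j] degree_constant(2)[OF assms k(1)] k(2) by metis
    also have "\<dots> < ?d True (Inl m)"
      by (rule degree_less[OF assms m])
    also have "\<dots> = ?d False e"
      using deg e by metis
    also have "\<dots> \<le> ?d False (Inl m)"
      using e(1) by (rule le)
    finally show False
      by simp
  qed
  moreover have "inj_on \<sigma> (Inl ` {1..m})"
    using bij by (auto simp: bij_betw_def E_def intro: inj_on_subset)
  ultimately have "\<sigma> ` Inl ` {1..m} = Inl ` {1..m}"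
    by (intro endo_inj_surj) auto
  moreover have "Inl ` {1..m} \<in> ?S False"
    using unprimed_block_iff[OF assms, of False] by blast
  then have "\<sigma> ` Inl ` {1..m} \<in> ?S True"
    unfolding img[symmetric] by blast
  ultimately have "Inl ` {1..m} \<in> ?S True"
    by (simp only:)
  then show False
    using unprimed_block_iff[OF assms, of True] by blast
qed

end
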